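(* Consider a position with finitely many piles of tokens in which every pile has an even number of tokens. Then it is a $\mathcal{P}$-position in Version B, and it is a $\mathcal{P}$-position in Version C.
   Context: Version B and Version C are two-player impartial games. A position consists of finitely many piles of tokens; empty piles are ignored. The players alternate turns, and the last player to move wins (a player with no legal move loses). In Version B, a player on their turn either removes a single token from any one nonempty pile, or removes one token from each (nonempty) pile. In Version C, a player on their turn either removes a single token from any one nonempty pile, or selects two different nonempty piles and removes one token from each of those two. A position is a $\mathcal{P}$-position if the player who is not about to move has a winning strategy, equivalently if none of its options (positions reachable in one move) is a $\mathcal{P}$-position; otherwise it is an $\mathcal{N}$-position. *)

theory Defs
  imports Main "HOL-Library.Multiset"
begin

text \<open>
  A position is the finite multiset of its pile sizes. Piles of size 0 may occur in the multiset,
  but no move ever takes a token from them.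
\<close>

type_synonym position = "nat multiset"

inductive take_one :: "position \<Rightarrow> position \<Rightarrow> bool" where
  "take_one (add_mset (Suc m) M) (add_mset m M)"

text \<open>
  The premise is needed: without it, a position having no tokens would have itself as an option.
  Truncated subtraction leaves empty piles empty.
\<close>

inductive take_from_each :: "position \<Rightarrow> position \<Rightarrow> bool" where
  "\<exists>m\<in>#M. m > 0 \<Longrightarrow> take_from_each M (image_mset (\<lambda>m. m - 1) M)"

text \<open>
  The two piles are different as piles, that is, as occurrences in the multiset; they may well have
  the same size.
\<close>

inductive take_from_two :: "position \<Rightarrow> position \<Rightarrow> bool" where
  "take_from_two (add_mset (Suc m) (add_mset (Suc n) M)) (add_mset m (add_mset n M))"

definition move_B :: "position \<Rightarrow> position \<Rightarrow> bool" where
  "move_B M N \<longleftrightarrow> take_one M N \<or> take_from_each M N"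

definition move_C :: "position \<Rightarrow> position \<Rightarrow> bool" where
  "move_C M N \<longleftrightarrow> take_one M N \<or> take_from_two M N"

text \<open>
  For an impartial game under normal play with move relation \<open>move\<close>, \<open>P_position move p\<close> says that
  the player who is not about to move at \<open>p\<close> has a winning strategy, and \<open>mover_wins move p\<close> that
  the player about to move has one. A position without options falls under the first rule.
  The lemma \<open>P_position_iff\<close> below gives the usual recursive characterization for games that
  always terminate.
\<close>

inductive P_position :: "('p \<Rightarrow> 'p \<Rightarrow> bool) \<Rightarrow> 'p \<Rightarrow> bool"
  and mover_wins :: "('p \<Rightarrow> 'p \<Rightarrow> bool) \<Rightarrow> 'p \<Rightarrow> bool"
  for move :: "'p \<Rightarrow> 'p \<Rightarrow> bool" where
  "(\<And>q. move p q \<Longrightarrow> mover_wins move q) \<Longrightarrow> P_position move p"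
| "move p q \<Longrightarrow> P_position move q \<Longrightarrow> mover_wins move p"

lemma mover_wins_iff:
  assumes "wfP (\<lambda>q p. move p q)"
  shows "mover_wins move p \<longleftrightarrow> \<not> P_position move p"
  using assms
proof (induction p rule: wfp_induct_rule)
  case (less p)
  then show ?case
    by (metis P_position.simps mover_wins.simps)
qed

lemma P_position_iff:
  assumes "wfP (\<lambda>q p. move p q)"
  shows "P_position move p \<longleftrightarrow> (\<forall>q. move p q \<longrightarrow> \<not> P_position move q)"
  using mover_wins_iff[OF assms] P_position.simps[of move p] by blast

lemma take_one_decreases: "take_one M N \<Longrightarrow> sum_mset N < sum_mset M"
  by (auto elim: take_one.cases)

lemma take_from_two_decreases: "take_from_two M N \<Longrightarrow> sum_mset N < sum_mset M"
  by (auto elim: take_from_two.cases)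

lemma take_from_each_decreases: 
  assumes "take_from_each M N"
  shows "sum_mset N < sum_mset M"
  using assms
proof cases
  case 1
  then obtain m M' where M: "M = add_mset m M'" and "m > 0"
    by (meson mset_add)
  have "(\<Sum>m\<in>#M'. m - 1) \<le> (\<Sum>m\<in>#M'. m)"
    by (rule sum_mset_mono) simp
  with \<open>m > 0\<close> show ?thesis
    by (simp add: 1 M)
qed

lemma wfP_move_B: "wfP (\<lambda>N M. move_B M N)"
  by (rule wfp_if_convertible_to_nat[where f = sum_mset])
    (auto simp: move_B_def take_one_decreases take_from_each_decreases)

lemma wfP_move_C: "wfP (\<lambda>N M. move_C M N)"
  by (rule wfp_if_convertible_to_nat[where f = sum_mset])
    (auto simp: move_C_def take_one_decreases take_from_two_decreases)

end

theory Submission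
  imports Defs
begin

text \<open>
  The second player can always restore evenness: after a move from an all-even position every pile
  that was touched is odd, hence nonempty, so the same move can be made on the same piles again.
\<close>

text \<open>An invariant \<open>S\<close> that the second player can always restore gives a winning
  strategy: the second player always has an answer, and since play terminates, it is the first
  player who runs out of moves.\<close>

lemma P_position_if_reply:
  assumes wf: "wfP (\<lambda>q p. move p q)"
    and "S p"
    and reply: "\<And>p q. S p \<Longrightarrow> move p q \<Longrightarrow> \<exists>r. move q r \<and> S r"
  shows "P_position move p"
proof -
  \<comment> \<open>The reply \<open>r\<close> lies two moves below \<open>p\<close>, so the
    induction hypothesis has to reach beyond immediate options.\<close>
  have "wfP (\<lambda>q p. move p q)\<^sup>+\<^sup>+"
    using wf by (rule wfp_tranclp)
  then show ?thesis
    using \<open>S p\<close>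
  proof (induction p rule: wfp_induct_rule)
    case (less p)
    show ?case
    proof (rule P_position_mover_wins.intros(1))
      fix q
      assume "move p q"
      then obtain r where "move q r" "S r"
        using reply less.prems by blast
      moreover have "(\<lambda>q p. move p q)\<^sup>+\<^sup>+ r p"
        using \<open>move p q\<close> \<open>move q r\<close>
        by (meson tranclp.r_into_trancl tranclp.trancl_into_trancl)
      ultimately show "mover_wins move q"
        using less.IH by (blast intro: P_position_mover_wins.intros(2))
    qed
  qed
qed

lemma take_one_reply:
  assumes "\<forall>m\<in>#M. even m" "take_one M N"
  shows "\<exists>L. take_one N L \<and> (\<forall>m\<in>#L. even m)"
  using assms(2)
proof cases
  case (1 m K)
  \<comment> \<open>The pile had the even size \<open>Suc m\<close>, so \<open>m\<close> is odd and
    cannot be 0; \<open>k\<close> is its size after the reply.\<close>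
  then obtain k where "m = Suc k"
    using assms(1) by (cases m) auto
  then show ?thesis
    using 1 assms(1) by (auto intro!: exI[of _ "add_mset k K"] take_one.intros)
qed

lemma take_from_two_reply:
  assumes "\<forall>m\<in>#M. even m" "take_from_two M N"
  shows "\<exists>L. take_from_two N L \<and> (\<forall>m\<in>#L. even m)"
  using assms(2)
proof cases
  case (1 m n K)
  then obtain k l where "m = Suc k" "n = Suc l"
    using assms(1) by (cases m; cases n) auto
  then show ?thesis
    using 1 assms(1)
    by (auto intro!: exI[of _ "add_mset k (add_mset l K)"] take_from_two.intros)
qed

lemma take_from_each_reply:
  assumes even: "\<forall>m\<in>#M. even m" and "take_from_each M N"
  shows "\<exists>L. take_from_each N L \<and> (\<forall>m\<in>#L. even m)"
  using assms(2)
proof cases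
  case 1
  then obtain m where m: "m \<in># M" "m > 0"
    by blast
  \<comment> \<open>A positive even pile has at least two tokens, so \<open>N\<close> still has a
    nonempty pile, as the premise of \<open>take_from_each\<close> demands.\<close>
  then have "m - 1 > 0"
    using even by (cases "m = 1") auto
  then have "take_from_each N (image_mset (\<lambda>m. m - 1) N)"
    using m by (intro take_from_each.intros) (auto simp: 1)
  \<comment> \<open>After both rounds a positive even pile has lost exactly two tokens, while an
    empty pile stays at 0 by truncation.\<close>
  moreover have "\<forall>m\<in>#image_mset (\<lambda>m. m - 1) N. even m"
    using even by (auto simp: 1)
  ultimately show ?thesis
    by blast
qed

theorem lemma1p1:
  fixes M :: position
  assumes "\<forall>m\<in>#M. even m"
  shows "P_position move_B M \<and> P_position move_C M"
proof
  show "P_position move_B M"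
    \<comment> \<open>The invariant is evenness of all piles; each of the two kinds of move is
      answered by its own reply lemma.\<close>
    by (rule P_position_if_reply[OF wfP_move_B, of "\<lambda>M. \<forall>m\<in>#M. even m", OF assms])
      (unfold move_B_def, blast dest: take_one_reply take_from_each_reply)
  show "P_position move_C M"
    by (rule P_position_if_reply[OF wfP_move_C, of "\<lambda>M. \<forall>m\<in>#M. even m", OF assms])
      (unfold move_C_def, blast dest: take_one_reply take_from_two_reply)
qed

end
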